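(* Consider biased SGD, $x_{k+1}=x_k-\alpha_k(u_k+e_k)$ with $u_k=\nabla f_{i_k}(x_k)$ and $\|e_k\|^2\le\delta^2\|u_k\|^2+c^2$, applied to $g=\frac1n\sum_{i=1}^n f_i$ with $g\in\mathcal{S}(m,\infty)$ for some $m>0$, and let $x_\star$ be the unique global minimizer of $g$. Suppose that one of the four conditions I–IV on the $f_i$ listed in the context holds, with corresponding $M$ and $G$, and put $\tilde M=M_{11}+2mM_{12}$. Assume further that $\alpha_k=\alpha>0$ for all $k$ (constant stepsize), $M_{21}\alpha\le1$, and either $\delta=0$ or $M_{21}=0$. Define $p,q,r,s\ge0$ by $$p=\tilde M\delta^2\alpha^2,\quad q=(c^2+2G^2\delta^2)\alpha^2,\quad r=1-2m\alpha+\tilde M\alpha^2,\quad s=2G^2\alpha^2 .$$ If $\sqrt p+\sqrt r<1$, then the following iterate error bound holds: $$\mathbb{E}\|x_k-x_\star\|^2\le\left(\frac{p\sqrt{\hat U_\star}}{\sqrt{p\hat U_\star+q}}+\frac{r\sqrt{\hat U_\star}}{\sqrt{r\hat U_\star+s}}\right)^k\mathbb{E}\|x_0-x_\star\|^2+\hat U_\star,$$ where the fixed point $\hat U_\star$ (of the recursion $\hat U_{k+1}=\bigl(\sqrt{p\hat U_k+q}+\sqrt{r\hat U_k+s}\bigr)^2$) is given by $$\hat U_\star=\frac{(p-r)(s-q)+q+s+2\sqrt{ps^2+q^2r+qs(1-p-r)}}{(p-r)^2-2(p+r)+1}.$$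
   Context: Setting. $n\ge1$ is an integer, $f_1,\dots,f_n:\mathbb{R}^d\to\mathbb{R}$ ($d\ge1$) are differentiable, and $g(x)=\frac1n\sum_{i=1}^n f_i(x)$. For $m>0$, $g\in\mathcal{S}(m,\infty)$ means that $g$ is differentiable, has a global minimizer $x_\star$, and $(x-x_\star)^{\mathsf T}\nabla g(x)\ge m\|x-x_\star\|^2$ for all $x\in\mathbb{R}^d$ (hence $x_\star$ is the unique minimizer and unique stationary point). Biased SGD. $x_{k+1}=x_k-\alpha_k(u_k+e_k)$ with $u_k=\nabla f_{i_k}(x_k)$ and stepsizes $\alpha_k$. The indices $i_k$ are IID uniform on $\{1,\dots,n\}$ and $i_k$ is independent of $x_k$. The errors $e_k$ are otherwise arbitrary (random, set in advance, or adversarial) but satisfy $\|e_k\|^2\le\delta^2\|u_k\|^2+c^2$ for every $k$, where $\delta,c\ge0$ are fixed known constants. Function class. For $0\le m\le L$, $0<L<\infty$, $\mathcal{F}(m,L)$ is the set of differentiable $f:\mathbb{R}^d\to\mathbb{R}$ with $-2m\|x-y\|^2+2(1+\frac mL)(x-y)^{\mathsf T}(\nabla f(x)-\nabla f(y))-\frac2L\|\nabla f(x)-\nabla f(y)\|^2\ge0$ for all $x,y$. $\mathcal{F}(0,L)$ is the class of convex $L$-smooth functions. A differentiable $f$ is $L$-smooth if $\|\nabla f(x)-\nabla f(y)\|\le L\|x-y\|$ for all $x,y$. The four cases (each condition is required for every $i$; $m$ is the same as in $g\in\mathcal{S}(m,\infty)$): I. $\|\nabla f_i(x)-mx\|\le\beta$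 for all $x$; $M=\begin{bmatrix} -m^2 & m \\ m & -1 \end{bmatrix}$, $G^2=\beta^2+m^2\|x_\star\|^2$. II. $f_i$ is $L$-smooth (not necessarily convex); $M=\begin{bmatrix} 2L^2 & 0 \\ 0 & -1 \end{bmatrix}$, $G^2=\frac1n\sum_{i=1}^n\|\nabla f_i(x_\star)\|^2$. III. $f_i\in\mathcal{F}(0,L)$; $M=\begin{bmatrix} 0 & L \\ L & -1 \end{bmatrix}$, $G^2=\frac1n\sum_{i=1}^n\|\nabla f_i(x_\star)\|^2$. IV. $f_i\in\mathcal{F}(m,L)$; $M=\begin{bmatrix} -2mL & L+m \\ L+m & -1 \end{bmatrix}$, $G^2=\frac1n\sum_{i=1}^n\|\nabla f_i(x_\star)\|^2$. Here $M_{ij}$ are the entries of $M$.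
   Formalization: Where a rate term is the undefined 0/0 (p=q=0, as for δ=c=0; r=s=0; or q=s=0, when Û⋆=0), it is given the value √p (resp. √r), its value for q=0 (resp. s=0) and Û⋆>0; elsewhere the stated formula is used unchanged. *)

theory Defs
  imports "HOL-Probability.Probability"
begin

definition grad :: "('a::euclidean_space \<Rightarrow> real) \<Rightarrow> 'a \<Rightarrow> 'a" where
  "grad f x = (THE D. GDERIV f x :> D)"

definition global_minimizer :: "('a \<Rightarrow> real) \<Rightarrow> 'a \<Rightarrow> bool" where
  "global_minimizer g z \<longleftrightarrow> (\<forall>y. g z \<le> g y)"

text \<open>The class \<open>\<S>(m, \<infinity>)\<close>.\<close>

definition S_infty :: "real \<Rightarrow> ('a::euclidean_space \<Rightarrow> real) set" where
  "S_infty m = {g. (\<forall>x. g differentiable (at x)) \<and>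
     (\<exists>z. global_minimizer g z \<and>
       (\<forall>x. (x - z) \<bullet> grad g x \<ge> m * (norm (x - z))\<^sup>2))}"

text \<open>The class \<open>\<F>(m, L)\<close>.\<close>

definition F_class :: "real \<Rightarrow> real \<Rightarrow> ('a::euclidean_space \<Rightarrow> real) set" where
  "F_class m L = {f. 0 \<le> m \<and> m \<le> L \<and> 0 < L \<and> (\<forall>x. f differentiable (at x)) \<and>
     (\<forall>x y. - 2 * m * (norm (x - y))\<^sup>2
        + 2 * (1 + m / L) * ((x - y) \<bullet> (grad f x - grad f y))
        - 2 / L * (norm (grad f x - grad f y))\<^sup>2 \<ge> 0)}"

definition L_smooth :: "real \<Rightarrow> ('a::euclidean_space \<Rightarrow> real) \<Rightarrow> bool" where
  "L_smooth L f \<longleftrightarrow> (\<forall>x. f differentiable (at x)) \<and>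
     (\<forall>x y. norm (grad f x - grad f y) \<le> L * norm (x - y))"

text \<open>The four admissible conditions on the components \<open>f 1, \<dots>, f n\<close>, each with its
  matrix \<open>M\<close> (listed by rows) and its constant \<open>G\<close>, which enters only through its square.\<close>

definition case_I :: "nat \<Rightarrow> (nat \<Rightarrow> 'a::euclidean_space \<Rightarrow> real) \<Rightarrow> real \<Rightarrow> 'a \<Rightarrow> real^2^2 \<Rightarrow> real \<Rightarrow> bool" where
  "case_I n f m xstar M G \<longleftrightarrow> (\<exists>\<beta>.
     (\<forall>i\<in>{1..n}. \<forall>x. norm (grad (f i) x - m *\<^sub>R x) \<le> \<beta>) \<and>
     M = vector [vector [- m\<^sup>2, m], vector [m, -1]] \<and>
     G\<^sup>2 = \<beta>\<^sup>2 + m\<^sup>2 * (norm xstar)\<^sup>2)"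

definition case_II :: "nat \<Rightarrow> (nat \<Rightarrow> 'a::euclidean_space \<Rightarrow> real) \<Rightarrow> real \<Rightarrow> 'a \<Rightarrow> real^2^2 \<Rightarrow> real \<Rightarrow> bool" where
  "case_II n f m xstar M G \<longleftrightarrow> (\<exists>L.
     (\<forall>i\<in>{1..n}. L_smooth L (f i)) \<and>
     M = vector [vector [2 * L\<^sup>2, 0], vector [0, -1]] \<and>
     G\<^sup>2 = 1 / real n * (\<Sum>i=1..n. (norm (grad (f i) xstar))\<^sup>2))"

definition case_III :: "nat \<Rightarrow> (nat \<Rightarrow> 'a::euclidean_space \<Rightarrow> real) \<Rightarrow> real \<Rightarrow> 'a \<Rightarrow> real^2^2 \<Rightarrow> real \<Rightarrow> bool" where
  "case_III n f m xstar M G \<longleftrightarrow> (\<exists>L.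
     (\<forall>i\<in>{1..n}. f i \<in> F_class 0 L) \<and>
     M = vector [vector [0, L], vector [L, -1]] \<and>
     G\<^sup>2 = 1 / real n * (\<Sum>i=1..n. (norm (grad (f i) xstar))\<^sup>2))"

definition case_IV :: "nat \<Rightarrow> (nat \<Rightarrow> 'a::euclidean_space \<Rightarrow> real) \<Rightarrow> real \<Rightarrow> 'a \<Rightarrow> real^2^2 \<Rightarrow> real \<Rightarrow> bool" where
  "case_IV n f m xstar M G \<longleftrightarrow> (\<exists>L.
     (\<forall>i\<in>{1..n}. f i \<in> F_class m L) \<and>
     M = vector [vector [- 2 * m * L, L + m], vector [L + m, -1]] \<and>
     G\<^sup>2 = 1 / real n * (\<Sum>i=1..n. (norm (grad (f i) xstar))\<^sup>2))"

text \<open>The library's \<open>indep_var\<close> forces both random variables to have the same range type;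
  this is the same notion for two different range types.\<close>

definition (in prob_space) indep_rv ::
    "'b measure \<Rightarrow> ('a \<Rightarrow> 'b) \<Rightarrow> 'c measure \<Rightarrow> ('a \<Rightarrow> 'c) \<Rightarrow> bool" where
  "indep_rv S X T Y \<longleftrightarrow> random_variable S X \<and> random_variable T Y \<and>
     indep_set {X -` A \<inter> space M | A. A \<in> sets S} {Y -` B \<inter> space M | B. B \<in> sets T}"

text \<open>\<open>idx k\<close>, \<open>x k\<close>, \<open>e k\<close> are the random index, iterate and error at step \<open>k\<close>. The joint law
  of the errors with everything else is unconstrained, except that \<open>idx k\<close> is independent
  of \<open>x k\<close>.\<close>

definition biased_sgd ::
    "'w measure \<Rightarrow> nat \<Rightarrow> (nat \<Rightarrow> 'a::euclidean_space \<Rightarrow> real) \<Rightarrow> (nat \<Rightarrow> real) \<Rightarrow> real \<Rightarrow> real \<Rightarrow>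
     (nat \<Rightarrow> 'w \<Rightarrow> nat) \<Rightarrow> (nat \<Rightarrow> 'w \<Rightarrow> 'a) \<Rightarrow> (nat \<Rightarrow> 'w \<Rightarrow> 'a) \<Rightarrow> bool" where
  "biased_sgd P n f step \<delta> c idx x e \<longleftrightarrow>
     prob_space P \<and>
     prob_space.indep_vars P (\<lambda>_. count_space {1..n}) idx UNIV \<and>
     (\<forall>k. distr P (count_space {1..n}) (idx k) = uniform_count_measure {1..n}) \<and>
     (\<forall>k. prob_space.indep_rv P (count_space {1..n}) (idx k) borel (x k)) \<and>
     (\<forall>k. e k \<in> borel_measurable P) \<and>
     (\<forall>k. AE \<omega> in P.
        x (Suc k) \<omega> = x k \<omega> - step k *\<^sub>R (grad (f (idx k \<omega>)) (x k \<omega>) + e k \<omega>)) \<and>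
     (\<forall>k. AE \<omega> in P.
        (norm (e k \<omega>))\<^sup>2 \<le> \<delta>\<^sup>2 * (norm (grad (f (idx k \<omega>)) (x k \<omega>)))\<^sup>2 + c\<^sup>2)"

text \<open>The quotient \<open>a * sqrt U / sqrt (a * U + b)\<close> for \<open>a, b, U \<ge> 0\<close>. It is the ill-defined \<open>0 / 0\<close>
  exactly if \<open>b = 0\<close> and \<open>a = 0 \<or> U = 0\<close>; for \<open>b = 0\<close> and \<open>a, U > 0\<close> it equals \<open>sqrt a\<close>, and the
  else branch extends it by this value. Isabelle's \<open>0 / 0 = 0\<close> would be wrong for \<open>U = 0 < a\<close>.\<close>

definition rate_term :: "real \<Rightarrow> real \<Rightarrow> real \<Rightarrow> real" where
  "rate_term a b U =
     (if a * U + b \<noteq> 0 then a * sqrt U / sqrt (a * U + b) else sqrt a)"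

end

theory Submission
  imports Defs
begin

text \<open>
  Averaging the condition on the \<open>f\<^sub>i\<close> over \<open>i\<close> bounds, at every point \<open>y\<close>, the mean of
  \<open>\<parallel>y - x\<^sub>\<star> - \<alpha>\<nabla>f\<^sub>i(y)\<parallel>\<^sup>2\<close> by \<open>r \<parallel>y - x\<^sub>\<star>\<parallel>\<^sup>2 + s\<close> and the mean size of \<open>\<alpha>\<^sup>2\<parallel>e\<parallel>\<^sup>2\<close> by
  \<open>p \<parallel>y - x\<^sub>\<star>\<parallel>\<^sup>2 + q\<close>. As nothing is known about the correlation of the error with the rest of the
  step, the two parts are combined by Young's inequality with a weight \<open>t\<close>. The weight that is optimal
  at the fixed point \<open>U\<^sub>\<star>\<close> turns this into an affine recursion \<open>V\<^sub>k\<^sub>+\<^sub>1 \<le> \<rho> V\<^sub>k + \<sigma>\<close> which also has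
  fixed point \<open>U\<^sub>\<star>\<close>, and whose slope \<open>\<rho>\<close> is the stated rate if \<open>U\<^sub>\<star> > 0\<close>, and
  its square if \<open>U\<^sub>\<star> = 0\<close>.

  All moments are taken in \<open>[0, \<infinity>]\<close>, where \<open>0 * \<infinity> = 0\<close>; so for \<open>\<rho> = 0\<close> the bound says something even
  if the initial moment is infinite.
\<close>

section \<open>The fixed point of the square-root recursion\<close>

text \<open>Scaling argument: for b \<ge> 0 and W > U > 0, passing from U to W multiplies sqrt (a U
  + b) by at most sqrt (W / U), and by strictly less if b > 0. So if q or s is nonzero, the sum of
  roots at W is strictly below sqrt (W / U) * sqrt U = sqrt W. If q = s = 0, then W > 0 would force
  sqrt p + sqrt r = 1; and U = 0 can be a fixed point only in this homogeneous case.\<close>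

lemma sqrt_sum_fixed_point_not_less:
  fixes p q r s U W :: real
  assumes nonneg: "0 \<le> p" "0 \<le> q" "0 \<le> r" "0 \<le> s"
    and lt: "sqrt p + sqrt r < 1"
    and U: "0 \<le> U" "sqrt (p * U + q) + sqrt (r * U + s) = sqrt U"
    and W: "sqrt (p * W + q) + sqrt (r * W + s) = sqrt W"
  shows "\<not> U < W"
proof
  assume UW: "U < W"
  have no_hom: "q \<noteq> 0 \<or> s \<noteq> 0"
  proof (rule ccontr)
    assume "\<not> (q \<noteq> 0 \<or> s \<noteq> 0)"
    with W have "(sqrt p + sqrt r) * sqrt W = sqrt W"
      by (simp add: real_sqrt_mult distrib_right)
    moreover have "sqrt W > 0" using U UW by simp
    ultimately show False using lt by simp
  qed
  show False
  proof (cases "U = 0")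
    case True
    with U have "sqrt q + sqrt s = 0" by simp
    then have "sqrt q = 0" "sqrt s = 0"
      using add_nonneg_eq_0_iff[of "sqrt q" "sqrt s"] nonneg by simp_all
    with no_hom show False by simp
  next
    case False
    with U have U0: "U > 0" by simp
    have scale: "sqrt (a * W + b) \<le> sqrt (W / U) * sqrt (a * U + b)"
        "b \<noteq> 0 \<Longrightarrow> sqrt (a * W + b) < sqrt (W / U) * sqrt (a * U + b)"
      if "0 \<le> a" "0 \<le> b" for a b
    proof -
      have eq: "W / U * (a * U + b) = a * W + b + (W / U - 1) * b"
        using U0 by (simp add: field_simps)
      have gt: "W / U - 1 > 0" using UW U0 by simp
      show "sqrt (a * W + b) \<le> sqrt (W / U) * sqrt (a * U + b)"
        using gt that by (simp only: real_sqrt_mult[symmetric] eq) simp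
      show "sqrt (a * W + b) < sqrt (W / U) * sqrt (a * U + b)" if "b \<noteq> 0"
        using gt that \<open>0 \<le> b\<close> by (simp only: real_sqrt_mult[symmetric] eq) simp
    qed
    have "sqrt (p * W + q) + sqrt (r * W + s)
        < sqrt (W / U) * (sqrt (p * U + q) + sqrt (r * U + s))"
      using no_hom scale[of p q] scale[of r s] nonneg by (auto simp: distrib_left)
    also have "\<dots> = sqrt (W / U * U)" by (simp only: U real_sqrt_mult)
    also have "\<dots> = sqrt W" using U0 by simp
    finally show False using W by simp
  qed
qed

text \<open>Squaring the fixed-point equation twice gives the quadratic D U^2 - 2 N U + (q - s)^2 =
  0, whose larger root is \<open>U\<^sub>0\<close>. The proof runs this backwards:
  \<open>U\<^sub>0\<close> solves the quadratic, and a sign condition at the larger root permits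
  taking the square root again.\<close>

lemma sqrt_sum_fixed_point:
  fixes p q r s U\<^sub>0 :: real
  assumes nonneg: "0 \<le> p" "0 \<le> q" "0 \<le> r" "0 \<le> s"
    and lt: "sqrt p + sqrt r < 1"
    and U0: "U\<^sub>0 = ((p - r) * (s - q) + q + s
            + 2 * sqrt (p * s\<^sup>2 + q\<^sup>2 * r + q * s * (1 - p - r)))
          / ((p - r)\<^sup>2 - 2 * (p + r) + 1)"
  shows "0 \<le> U\<^sub>0" "sqrt (p * U\<^sub>0 + q) + sqrt (r * U\<^sub>0 + s) = sqrt U\<^sub>0"
proof -
  define \<kappa> where "\<kappa> = 1 - p - r"
  define D where "D = (p - r)\<^sup>2 - 2 * (p + r) + 1"
  define N where "N = (p - r) * (s - q) + q + s"
  define R where "R = p * s\<^sup>2 + q\<^sup>2 * r + q * s * (1 - p - r)"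
  have "(sqrt p + sqrt r)\<^sup>2 < 1"
    using lt nonneg by (simp add: power_less_one_iff abs_square_less_1)
  then have lt': "p + r + 2 * (sqrt p * sqrt r) < 1"
    using nonneg by (simp add: power2_sum)
  have sq0: "0 \<le> sqrt p * sqrt r" using nonneg by simp
  have \<kappa>: "2 * (sqrt p * sqrt r) < \<kappa>" "0 < \<kappa>" using lt' sq0 by (auto simp: \<kappa>_def)
  have D\<kappa>: "D = \<kappa>\<^sup>2 - 4 * (p * r)"
    by (simp add: D_def \<kappa>_def power2_eq_square algebra_simps)
  \<comment> \<open>D = \<open>\<kappa>\<close>^2 - 4 p r is positive because
    \<open>\<kappa>\<close> > 2 sqrt (p r) is just (sqrt p + sqrt r)^2 < 1 rearranged.\<close>
  have "(2 * (sqrt p * sqrt r))\<^sup>2 < \<kappa>\<^sup>2"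
    using \<kappa> sq0 by (intro power_strict_mono) auto
  then have D: "D > 0" using nonneg by (simp add: D\<kappa> power_mult_distrib)
  have R: "R \<ge> 0" using nonneg \<kappa> by (simp add: R_def \<kappa>_def[symmetric])
  have N: "N = \<kappa> * (q + s) + 2 * (p * s + q * r)"
    by (simp add: N_def \<kappa>_def algebra_simps)
  have N0: "N \<ge> 0" using nonneg \<kappa> by (simp add: N)
  have U0': "U\<^sub>0 = (N + 2 * sqrt R) / D" by (simp add: U0 N_def R_def D_def)
  show nn: "0 \<le> U\<^sub>0" using N0 D R by (simp add: U0')
  have DU: "D * U\<^sub>0 = N + 2 * sqrt R" using D by (simp add: U0')
  \<comment> \<open>Prepares the sign condition q + s \<le> \<open>\<kappa>\<close>
    \<open>U\<^sub>0\<close>, without which the squared equation would only determine its root up to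
    sign.\<close>
  have "D * (q + s) \<le> \<kappa> * N"
  proof -
    have "\<kappa> * N = D * (q + s) + 2 * \<kappa> * (p * s + q * r) + 4 * (p * r) * (q + s)"
      by (simp add: N D\<kappa> power2_eq_square algebra_simps)
    then show ?thesis using nonneg \<kappa> by simp
  qed
  also have "\<dots> \<le> \<kappa> * (D * U\<^sub>0)" using \<kappa> R by (simp add: DU)
  also have "\<dots> = D * (\<kappa> * U\<^sub>0)" by simp
  finally have ge: "q + s \<le> \<kappa> * U\<^sub>0" using D by simp
  have "(D * U\<^sub>0 - N)\<^sup>2 = 4 * R" using R by (simp add: DU power_mult_distrib)
  \<comment> \<open>4 R is N^2 - D (q - s)^2, a quarter of the discriminant, so completing the
    square turns the closed form into the quadratic.\<close>
  moreover have "N\<^sup>2 - 4 * R = D * (q - s)\<^sup>2"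
    by (simp add: N_def R_def D_def power2_eq_square algebra_simps)
  ultimately have "D * (D * U\<^sub>0\<^sup>2 - 2 * N * U\<^sub>0 + (q - s)\<^sup>2) = 0"
    by (simp add: power2_eq_square algebra_simps)
  then have "D * U\<^sub>0\<^sup>2 - 2 * N * U\<^sub>0 + (q - s)\<^sup>2 = 0" using D by simp
  then have "(\<kappa> * U\<^sub>0 - (q + s))\<^sup>2 = 4 * ((p * U\<^sub>0 + q) * (r * U\<^sub>0 + s))"
    by (simp add: N D\<kappa> power2_eq_square algebra_simps)
  then have "\<kappa> * U\<^sub>0 - (q + s) = sqrt (4 * ((p * U\<^sub>0 + q) * (r * U\<^sub>0 + s)))"
    using ge by (intro real_sqrt_unique[symmetric]) auto
  then have "\<kappa> * U\<^sub>0 - (q + s) = 2 * (sqrt (p * U\<^sub>0 + q) * sqrt (r * U\<^sub>0 + s))"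
    by (simp add: real_sqrt_mult)
  then have "(sqrt (p * U\<^sub>0 + q) + sqrt (r * U\<^sub>0 + s))\<^sup>2 = U\<^sub>0"
    using nn nonneg by (simp add: power2_sum \<kappa>_def algebra_simps)
  then show "sqrt (p * U\<^sub>0 + q) + sqrt (r * U\<^sub>0 + s) = sqrt U\<^sub>0"
    using nn nonneg by (intro real_sqrt_unique[symmetric]) auto
qed

section \<open>From Young's inequality to an affine recursion in [0, \<infinity>]\<close>

text \<open>This is the limit t \<rightarrow> 0, taken when the optimal Young weight degenerates to
  0 or \<infinity>. An infinite W is trivial; for finite w the denominator w + 1 in \<open>t\<close>
  covers w = 0 as well.\<close>

lemma ennreal_le_if_le_scaled:
  fixes V W :: ennreal
  assumes "\<And>t::real. t > 0 \<Longrightarrow> V \<le> ennreal (1 + t) * W"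
  shows "V \<le> W"
proof (cases W)
  case (real w)
  show ?thesis
  proof (rule ennreal_le_epsilon)
    fix e :: real assume e: "0 < e"
    define t where "t = e / (w + 1)"
    have t: "t > 0" "t * w \<le> e" using e real by (auto simp: t_def field_simps)
    have "V \<le> ennreal (1 + t) * W" using assms t by simp
    also have "\<dots> = ennreal (w + t * w)"
      using t real by (simp add: ennreal_mult[symmetric] algebra_simps)
    also have "\<dots> \<le> ennreal (w + e)" using t by (intro ennreal_leI) simp
    also have "\<dots> = W + ennreal e" using real e by simp
    finally show "V \<le> W + ennreal e" .
  qed
qed simp

lemma ennreal_affine_scaled:
  assumes "0 \<le> t" "0 \<le> a" "0 \<le> b"
  shows "ennreal (t * a) * V + ennreal (t * b) = ennreal t * (ennreal a * V + ennreal b)"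
  using assms by (simp add: ennreal_mult distrib_left mult.assoc)

text \<open>The rate and offset of the affine bound come from the weight \<open>t\<close> that makes Young's
  inequality tight at the fixed point, so that the affine map also fixes \<open>U\<close>.\<close>

lemma affine_bound_at_fixed_point:
  fixes p q r s U :: real and V V' :: ennreal
  assumes nonneg: "0 \<le> p" "0 \<le> q" "0 \<le> r" "0 \<le> s" "0 \<le> U"
    and lt: "sqrt p + sqrt r < 1"
    and fp: "sqrt (p * U + q) + sqrt (r * U + s) = sqrt U"
    and young: "\<And>t. t > 0 \<Longrightarrow>
      V' \<le> ennreal ((1 + t) * r + (1 + 1/t) * p) * V + ennreal ((1 + t) * s + (1 + 1/t) * q)"
  shows "\<exists>\<sigma>\<ge>0. V' \<le> ennreal (rate_term p q U + rate_term r s U) * V + ennreal \<sigma>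
    \<and> (rate_term p q U + rate_term r s U) * U + \<sigma> = U"
proof -
  define a b where "a = sqrt (r * U + s)" and "b = sqrt (p * U + q)"
  have ab: "0 \<le> a" "0 \<le> b" "a\<^sup>2 = r * U + s" "b\<^sup>2 = p * U + q" "a + b = sqrt U"
    using nonneg fp by (auto simp: a_def b_def)
  \<comment> \<open>Replacing t by 1/t exchanges the roles of (p, q) and (r, s).\<close>
  have young': "V' \<le> ennreal ((1 + t) * p + (1 + 1/t) * r) * V
      + ennreal ((1 + t) * q + (1 + 1/t) * s)" if "t > 0" for t
    using young[of "1/t"] that by (simp add: add.commute)
  consider "U = 0" | "U > 0" "a = 0" | "U > 0" "b = 0" | "U > 0" "a > 0" "b > 0"
    using nonneg ab by linarith
  then show ?thesis
  proof cases
    case 1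
    then have "a = 0" "b = 0" using ab by auto
    with 1 ab have qs: "q = 0" "s = 0" by auto
    have rate: "rate_term p q U = sqrt p" "rate_term r s U = sqrt r"
      by (simp_all add: rate_term_def 1 qs)
    \<comment> \<open>Covers p = 0 or r = 0. For u > 0 the weight is the one with (1 + t) u = sqrt
      u, and it is positive because sqrt u < 1.\<close>
    have one_zero: "V' \<le> ennreal (sqrt u) * V"
      if u: "0 \<le> u" "sqrt u < 1"
        and le: "\<And>t. t > 0 \<Longrightarrow> V' \<le> ennreal ((1 + t) * u) * V" for u
    proof (cases "u = 0")
      case True
      then show ?thesis using le[of 1] by simp
    next
      case False
      then have "u > 0" using u by simp
      then have "(1 + (1 / sqrt u - 1)) * u = sqrt u" "1 / sqrt u - 1 > 0"
        using u by (simp_all add: real_div_sqrt)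
      then show ?thesis using le[of "1 / sqrt u - 1"] by simp
    qed
    have "V' \<le> ennreal (sqrt p + sqrt r) * V"
    proof -
      consider "p = 0" | "r = 0" | "p > 0" "r > 0" using nonneg by linarith
      then show ?thesis
      proof cases
        case 1
        then show ?thesis using one_zero[of r] young nonneg lt qs by simp
      next
        case 2
        then show ?thesis using one_zero[of p] young' nonneg lt qs by simp
      next
        case 3
        \<comment> \<open>At U = 0 the ratio b / a is 0 / 0. This weight minimises the slope
          instead; the minimum (sqrt p + sqrt r)^2 is at most the rate sqrt p + sqrt r because the
          latter is below 1.\<close>
        define t where "t = sqrt p / sqrt r"
        have t: "t > 0" using 3 by (simp add: t_def)
        have "(1 + t) * r + (1 + 1/t) * p = (sqrt p + sqrt r) * (sqrt p + sqrt r)"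
        proof -
          have "(1 + t) * (sqrt r)\<^sup>2 + (1 + 1/t) * (sqrt p)\<^sup>2 = (sqrt p + sqrt r) * (sqrt p + sqrt r)"
            using 3 unfolding t_def by (simp add: field_simps power2_eq_square del: real_sqrt_mult_self)
          then show ?thesis using 3 by simp
        qed
        also have "\<dots> \<le> sqrt p + sqrt r"
          using lt nonneg by (intro mult_left_le) auto
        finally have le: "ennreal ((1 + t) * r + (1 + 1/t) * p) \<le> ennreal (sqrt p + sqrt r)"
          by (rule ennreal_leI)
        have "V' \<le> ennreal ((1 + t) * r + (1 + 1/t) * p) * V" using young[OF t] qs by simp
        also have "\<dots> \<le> ennreal (sqrt p + sqrt r) * V" by (rule mult_right_mono[OF le]) simp
        finally show ?thesis .
      qed
    qed
    then show ?thesis unfolding rate using 1 by (intro exI[of _ 0]) simp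
  next
    case 2
    then have rs: "r = 0" "s = 0" using ab nonneg
      by (metis add_nonneg_eq_0_iff mult_eq_0_iff mult_nonneg_nonneg order_less_irrefl power_zero_numeral)+
    have U: "p * U + q = U" using 2 ab by simp
    have rate: "rate_term p q U = p" "rate_term r s U = 0"
      using 2 by (simp_all add: rate_term_def U rs)
    \<comment> \<open>The optimal weight b / a would be infinite; in the exchanged form of Young's
      inequality this is the limit t \<rightarrow> 0. Case 3, where b = 0, mirrors it.\<close>
    have "V' \<le> ennreal p * V + ennreal q"
      by (rule ennreal_le_if_le_scaled)
        (use young' nonneg rs in \<open>simp add: ennreal_affine_scaled\<close>)
    then show ?thesis using rate U nonneg by (intro exI[of _ q]) simp
  next
    case 3
    then have pq: "p = 0" "q = 0" using ab nonneg
      by (metis add_nonneg_eq_0_iff mult_eq_0_iff mult_nonneg_nonneg order_less_irrefl power_zero_numeral)+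
    have U: "r * U + s = U" using 3 ab by simp
    have rate: "rate_term r s U = r" "rate_term p q U = 0"
      using 3 by (simp_all add: rate_term_def U pq)
    have "V' \<le> ennreal r * V + ennreal s"
      by (rule ennreal_le_if_le_scaled)
        (use young nonneg pq in \<open>simp add: ennreal_affine_scaled\<close>)
    then show ?thesis using rate U nonneg by (intro exI[of _ s]) simp
  next
    case 4
    \<comment> \<open>Equality in Young's inequality for the numbers a and b: since a + b = sqrt U,
      the combination (1 + t) a^2 + (1 + 1/t) b^2 collapses to sqrt U * (a + b) = U, and the factors
      1 + t, 1 + 1/t produce exactly the two rate terms.\<close>
    define t where "t = b / a"
    have t: "t > 0" "1 + t = sqrt U / a" "1 + 1/t = sqrt U / b"
      using 4 ab(5) by (auto simp: t_def field_simps)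
    have rate: "rate_term p q U = (1 + 1/t) * p" "rate_term r s U = (1 + t) * r"
      using 4 ab(3,4) unfolding t by (auto simp: rate_term_def a_def b_def)
    let ?\<sigma> = "(1 + t) * s + (1 + 1/t) * q"
    have "(rate_term p q U + rate_term r s U) * U + ?\<sigma> = (1 + t) * a\<^sup>2 + (1 + 1/t) * b\<^sup>2"
      unfolding rate ab(3,4) by (simp add: algebra_simps)
    also have "\<dots> = sqrt U * (a + b)"
      using 4 unfolding t by (simp add: power2_eq_square algebra_simps)
    also have "\<dots> = U" using nonneg ab by simp
    finally have "(rate_term p q U + rate_term r s U) * U + ?\<sigma> = U" .
    moreover have "V' \<le> ennreal (rate_term p q U + rate_term r s U) * V + ennreal ?\<sigma>"
      using young[OF t(1)] unfolding rate by (simp add: add.commute)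
    moreover have "?\<sigma> \<ge> 0" using t(1) nonneg by simp
    ultimately show ?thesis by blast
  qed
qed

lemma rate_term_nonneg: "0 \<le> a \<Longrightarrow> 0 \<le> U \<Longrightarrow> 0 \<le> b \<Longrightarrow> 0 \<le> rate_term a b U"
  by (simp add: rate_term_def)

text \<open>Since the affine map fixes U, it carries \<rho>^k V_0 + U to \<rho>^(k+1) V_0 + U; this
  invariant involves no subtraction in [0, \<infinity>].\<close>

lemma ennreal_affine_recursion:
  fixes V :: "nat \<Rightarrow> ennreal" and \<rho> U :: real
  assumes "0 \<le> \<rho>" "0 \<le> U"
    and step: "\<And>k. \<exists>\<sigma>\<ge>0. V (Suc k) \<le> ennreal \<rho> * V k + ennreal \<sigma> \<and> \<rho> * U + \<sigma> = U"
  shows "V k \<le> ennreal (\<rho> ^ k) * V 0 + ennreal U"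
proof (induction k)
  case 0
  show ?case by simp
next
  case (Suc k)
  obtain \<sigma> where \<sigma>: "\<sigma> \<ge> 0" "V (Suc k) \<le> ennreal \<rho> * V k + ennreal \<sigma>" "\<rho> * U + \<sigma> = U"
    using step by blast
  have "V (Suc k) \<le> ennreal \<rho> * (ennreal (\<rho> ^ k) * V 0 + ennreal U) + ennreal \<sigma>"
    using \<sigma>(2) Suc.IH by (meson add_right_mono mult_left_mono order_trans zero_le)
  also have "\<dots> = ennreal (\<rho> ^ Suc k) * V 0 + ennreal (\<rho> * U + \<sigma>)"
    using assms \<sigma>(1) by (simp add: ennreal_mult distrib_left mult.assoc add.assoc)
  finally show ?case by (simp only: \<sigma>(3))
qed

section \<open>Gradients, minimizers and measurability\<close>

lemma GDERIV_unique:
  fixes f :: "'a::euclidean_space \<Rightarrow> real"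
  assumes "GDERIV f x :> D" "GDERIV f x :> E"
  shows "D = E"
proof -
  have "(\<lambda>h. h \<bullet> D) = (\<lambda>h. h \<bullet> E)"
    using assms unfolding gderiv_def by (rule has_derivative_unique)
  then have "(D - E) \<bullet> D = (D - E) \<bullet> E" by (rule fun_cong)
  then have "(D - E) \<bullet> (D - E) = 0" by (simp only: inner_diff_right diff_self)
  then show ?thesis by simp
qed

lemma grad_eqI:
  fixes f :: "'a::euclidean_space \<Rightarrow> real"
  shows "GDERIV f x :> D \<Longrightarrow> grad f x = D"
  unfolding grad_def by (rule the_equality) (auto dest: GDERIV_unique)

text \<open>\<open>grad\<close> is a definite description, so a gradient has to be exhibited first:
  the vector whose coordinates are the values of the derivative on the basis.\<close>

lemma GDERIV_grad:
  fixes f :: "'a::euclidean_space \<Rightarrow> real"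
  assumes "f differentiable (at x)"
  shows "GDERIV f x :> grad f x"
proof -
  obtain f' where f': "(f has_derivative f') (at x)"
    using assms by (auto simp: differentiable_def)
  interpret linear f' using f' by (rule has_derivative_linear)
  have "f' h = h \<bullet> (\<Sum>b\<in>Basis. f' b *\<^sub>R b)" for h
  proof -
    have "f' h = f' (\<Sum>b\<in>Basis. (h \<bullet> b) *\<^sub>R b)" by (simp add: euclidean_representation)
    also have "\<dots> = (\<Sum>b\<in>Basis. (h \<bullet> b) * f' b)" by (simp add: sum scale)
    finally show ?thesis by (simp add: inner_sum_right mult.commute)
  qed
  then have "f' = (\<lambda>h. h \<bullet> (\<Sum>b\<in>Basis. f' b *\<^sub>R b))" by (rule ext)
  with f' have D: "GDERIV f x :> (\<Sum>b\<in>Basis. f' b *\<^sub>R b)"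
    unfolding gderiv_def by (rule back_subst)
  show ?thesis unfolding grad_eqI[OF D] by (rule D)
qed

lemma grad_average:
  fixes f :: "nat \<Rightarrow> 'a::euclidean_space \<Rightarrow> real"
  assumes "\<And>i. i \<in> I \<Longrightarrow> f i differentiable (at x)"
  shows "grad (\<lambda>y. c * (\<Sum>i\<in>I. f i y)) x = c *\<^sub>R (\<Sum>i\<in>I. grad (f i) x)"
proof (rule grad_eqI, unfold gderiv_def)
  have "((\<lambda>y. c * (\<Sum>i\<in>I. f i y)) has_derivative (\<lambda>h. c * (\<Sum>i\<in>I. h \<bullet> grad (f i) x))) (at x)"
    using GDERIV_grad[OF assms, unfolded gderiv_def]
    by (intro has_derivative_mult_right has_derivative_sum)
  then show "((\<lambda>y. c * (\<Sum>i\<in>I. f i y)) has_derivative (\<lambda>h. h \<bullet> (c *\<^sub>R (\<Sum>i\<in>I. grad (f i) x)))) (at x)"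
    by (simp add: inner_sum_right)
qed

lemma grad_global_minimizer:
  fixes g :: "'a::euclidean_space \<Rightarrow> real"
  assumes "g differentiable (at z)" "global_minimizer g z"
  shows "grad g z = 0"
proof -
  have "(\<lambda>h. h \<bullet> grad g z) = (\<lambda>h. 0)"
    using GDERIV_grad[OF assms(1), unfolded gderiv_def] assms(2)
    by (intro has_derivative_local_min) (auto simp: global_minimizer_def)
  then have "grad g z \<bullet> grad g z = 0" by (rule fun_cong)
  then show ?thesis by simp
qed

text \<open>\<open>S_infty\<close> supplies the inequality for some minimizer w only. The gradient
  vanishes at z, so the inequality taken at z gives m * (norm (z - w))^2 \<le> 0 and z = w.\<close>

lemma S_infty_grad_bound:
  fixes g :: "'a::euclidean_space \<Rightarrow> real"
  assumes "g \<in> S_infty m" "m > 0" "global_minimizer g z"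
  shows "m * (norm (x - z))\<^sup>2 \<le> (x - z) \<bullet> grad g x"
proof -
  obtain w where w: "\<And>x. m * (norm (x - w))\<^sup>2 \<le> (x - w) \<bullet> grad g x"
    and diff: "g differentiable (at z)"
    using assms(1) by (auto simp: S_infty_def)
  have "m * (norm (z - w))\<^sup>2 \<le> 0"
    using w[of z] grad_global_minimizer[OF diff assms(3)] by simp
  then have "z = w"
    using assms(2) by (simp add: mult_le_0_iff)
  with w show ?thesis by simp
qed

text \<open>Measurability needs no continuity of the gradient: its components are limits of
  difference quotients.\<close>

lemma borel_measurable_grad:
  fixes f :: "'a::euclidean_space \<Rightarrow> real"
  assumes diff: "\<And>x. f differentiable (at x)"
  shows "grad f \<in> borel_measurable borel"
proof -
  have "continuous_on UNIV f"
    using diff by (meson continuous_at_imp_continuous_on differentiable_imp_continuous_within)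
  then have f[measurable]: "f \<in> borel_measurable borel"
    by (rule borel_measurable_continuous_onI)
  have "(\<lambda>x. grad f x \<bullet> b) \<in> borel_measurable borel" if "b \<in> Basis" for b
  proof (rule borel_measurable_LIMSEQ_real)
    fix x :: 'a
    have "((\<lambda>t. f (x + t *\<^sub>R b)) has_real_derivative (b \<bullet> grad f x)) (at 0)"
    proof -
      have "(f has_derivative (\<lambda>h. h \<bullet> grad f x)) (at (x + 0 *\<^sub>R b))"
        using GDERIV_grad[OF diff, unfolded gderiv_def] by simp
      moreover have "((\<lambda>t. x + t *\<^sub>R b) has_derivative (\<lambda>t. t *\<^sub>R b)) (at (0::real))"
        by (auto intro!: derivative_eq_intros)
      ultimately have "((\<lambda>t. f (x + t *\<^sub>R b)) has_derivative (\<lambda>t. (t *\<^sub>R b) \<bullet> grad f x)) (at 0)"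
        using has_derivative_compose[of "\<lambda>t. x + t *\<^sub>R b" "\<lambda>t. t *\<^sub>R b" 0 UNIV f
            "\<lambda>h. h \<bullet> grad f x"] by simp
      then show ?thesis
        by (simp add: has_field_derivative_def mult.commute[of _ "b \<bullet> grad f x"])
    qed
    then have "((\<lambda>h. (f (x + h *\<^sub>R b) - f x) / h) \<longlongrightarrow> b \<bullet> grad f x) (at 0)"
      by (simp add: DERIV_def)
    moreover have "filterlim (\<lambda>j. inverse (real (Suc j))) (at 0) sequentially"
      using LIMSEQ_inverse_real_of_nat by (simp add: filterlim_at)
    ultimately show "(\<lambda>j. (f (x + inverse (real (Suc j)) *\<^sub>R b) - f x) / inverse (real (Suc j)))
        \<longlonglongrightarrow> grad f x \<bullet> b"
      unfolding inner_commute[of "grad f x"] by (rule filterlim_compose)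
  qed measurable
  then show ?thesis
    using borel_measurable_euclidean_space by blast
qed

section \<open>Second moment of the component gradients in the four cases\<close>

lemma norm_diff_scaleR_sq:
  fixes u d :: "'a::real_inner"
  shows "(norm (u - a *\<^sub>R d))\<^sup>2 = (norm u)\<^sup>2 - 2 * a * (d \<bullet> u) + a\<^sup>2 * (norm d)\<^sup>2"
  by (simp add: power2_norm_eq_inner inner_diff inner_commute power2_eq_square[of a] algebra_simps)

lemma norm_sq_le_twice:
  fixes u v :: "'a::real_inner"
  shows "(norm u)\<^sup>2 \<le> 2 * (norm (u - v))\<^sup>2 + 2 * (norm v)\<^sup>2"
proof -
  \<comment> \<open>The difference of the two sides is exactly this square.\<close>
  have "0 \<le> (norm (u - 2 *\<^sub>R v))\<^sup>2" by simp
  then show ?thesis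
    by (simp add: power2_norm_eq_inner inner_diff inner_commute algebra_simps)
qed

lemma norm_add_sq_young:
  fixes a b :: "'a::real_inner"
  assumes "t > 0"
  shows "(norm (a + b))\<^sup>2 \<le> (1 + t) * (norm a)\<^sup>2 + (1 + 1/t) * (norm b)\<^sup>2"
proof -
  \<comment> \<open>The difference of the two sides is exactly this quotient.\<close>
  have "0 \<le> (norm (t *\<^sub>R a - b))\<^sup>2 / t" using assms by simp
  also have "\<dots> = t * (norm a)\<^sup>2 - 2 * (a \<bullet> b) + (norm b)\<^sup>2 / t"
    using assms by (simp add: power2_norm_eq_inner inner_diff inner_commute field_simps)
  finally show ?thesis
    by (simp add: power2_norm_eq_inner inner_add inner_commute algebra_simps)
qed

text \<open>The defining inequality times L > 0. The factor 2 on the left is the one that splitting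
  off \<open>grad f y\<close> costs, so the coefficients on the right are the entries of
  \<open>M\<close> in case IV and, for m = 0, in case III.\<close>

lemma F_class_cocoercive:
  assumes "f \<in> F_class m L"
  shows "2 * (norm (grad f x - grad f y))\<^sup>2 \<le> - 2 * m * L * (norm (x - y))\<^sup>2
    + 2 * (L + m) * ((x - y) \<bullet> (grad f x - grad f y))"
proof -
  have L: "L > 0" using assms by (simp add: F_class_def)
  have "0 \<le> L * (- 2 * m * (norm (x - y))\<^sup>2
        + 2 * (1 + m / L) * ((x - y) \<bullet> (grad f x - grad f y))
        - 2 / L * (norm (grad f x - grad f y))\<^sup>2)"
    using assms L by (intro mult_nonneg_nonneg) (auto simp: F_class_def)
  also have "\<dots> = - 2 * m * L * (norm (x - y))\<^sup>2
    + 2 * (L + m) * ((x - y) \<bullet> (grad f x - grad f y)) - 2 * (norm (grad f x - grad f y))\<^sup>2"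
    using L by (simp add: field_simps)
  finally show ?thesis by simp
qed

text \<open>In cases II to IV the hypothesis controls the difference of gradients at y and z.
  Splitting off the gradient at z costs a factor 2 and produces 2 G^2, and in the average the cross
  term with the gradients at z disappears because they sum to 0. Case I bounds each gradient
  directly.\<close>

lemma second_moment_case_bound:
  fixes f :: "nat \<Rightarrow> 'a::euclidean_space \<Rightarrow> real"
  assumes n: "n \<ge> 1"
    and stationary: "(\<Sum>i=1..n. grad (f i) z) = 0"
    and cases: "case_I n f m z M G \<or> case_II n f m z M G \<or> case_III n f m z M G \<or> case_IV n f m z M G"
  shows "(\<Sum>i=1..n. (norm (grad (f i) y))\<^sup>2) \<le> real n * (M $ 1 $ 1 * (norm (y - z))\<^sup>2)
    + 2 * M $ 1 $ 2 * ((y - z) \<bullet> (\<Sum>i=1..n. grad (f i) y)) + 2 * real n * G\<^sup>2"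
proof -
  have avg: ?thesis
    if termwise: "\<And>i. i \<in> {1..n} \<Longrightarrow> (norm (grad (f i) y))\<^sup>2 \<le> M $ 1 $ 1 * (norm (y - z))\<^sup>2
        + 2 * M $ 1 $ 2 * ((y - z) \<bullet> (grad (f i) y - grad (f i) z)) + 2 * (norm (grad (f i) z))\<^sup>2"
      and G: "G\<^sup>2 = 1 / real n * (\<Sum>i=1..n. (norm (grad (f i) z))\<^sup>2)"
  proof -
    have "(\<Sum>i=1..n. (norm (grad (f i) y))\<^sup>2) \<le> (\<Sum>i=1..n. M $ 1 $ 1 * (norm (y - z))\<^sup>2
        + 2 * M $ 1 $ 2 * ((y - z) \<bullet> (grad (f i) y - grad (f i) z)) + 2 * (norm (grad (f i) z))\<^sup>2)"
      by (rule sum_mono[OF termwise])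
    also have "\<dots> = real n * (M $ 1 $ 1 * (norm (y - z))\<^sup>2)
        + 2 * M $ 1 $ 2 * ((y - z) \<bullet> (\<Sum>i=1..n. grad (f i) y - grad (f i) z))
        + 2 * (\<Sum>i=1..n. (norm (grad (f i) z))\<^sup>2)"
      by (simp add: sum.distrib inner_sum_right sum_distrib_left)
    also have "(\<Sum>i=1..n. (norm (grad (f i) z))\<^sup>2) = real n * G\<^sup>2"
      using n by (simp add: G)
    also have "(\<Sum>i=1..n. grad (f i) y - grad (f i) z) = (\<Sum>i=1..n. grad (f i) y)"
      by (simp only: sum_subtractf stationary diff_zero)
    finally show ?thesis by simp
  qed
  from cases consider "case_I n f m z M G" | "case_II n f m z M G"
    | "case_III n f m z M G" | "case_IV n f m z M G" by blast
  then show ?thesis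
  proof cases
    case 1
    then obtain \<beta> where \<beta>: "\<And>i x. i \<in> {1..n} \<Longrightarrow> norm (grad (f i) x - m *\<^sub>R x) \<le> \<beta>"
      and M: "M $ 1 $ 1 = - m\<^sup>2" "M $ 1 $ 2 = m"
      and G: "G\<^sup>2 = \<beta>\<^sup>2 + m\<^sup>2 * (norm z)\<^sup>2"
      unfolding case_I_def by (elim exE conjE) (rule that, simp_all)
    have "(norm (grad (f i) y))\<^sup>2 \<le> M $ 1 $ 1 * (norm (y - z))\<^sup>2
        + 2 * M $ 1 $ 2 * ((y - z) \<bullet> grad (f i) y) + 2 * G\<^sup>2" if i: "i \<in> {1..n}" for i
    proof -
      let ?u = "grad (f i) y"
      \<comment> \<open>The hypothesis is centred at the origin, not at z: ?u - m (y - z) is (?u - m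
        y) + m z, and the shift m z accounts for the second summand of G^2.\<close>
      have "(norm (?u - m *\<^sub>R (y - z)))\<^sup>2 \<le> 2 * (norm (?u - m *\<^sub>R y))\<^sup>2 + 2 * (norm (m *\<^sub>R z))\<^sup>2"
        using norm_sq_le_twice[of "?u - m *\<^sub>R (y - z)" "m *\<^sub>R z"] by (simp add: algebra_simps)
      also have "\<dots> \<le> 2 * \<beta>\<^sup>2 + 2 * (m\<^sup>2 * (norm z)\<^sup>2)"
        using power_mono[OF \<beta>[OF i, of y], of 2] by (simp add: power_mult_distrib)
      moreover have "(norm (?u - m *\<^sub>R (y - z)))\<^sup>2
          = (norm ?u)\<^sup>2 - 2 * m * ((y - z) \<bullet> ?u) + m\<^sup>2 * (norm (y - z))\<^sup>2"
        by (rule norm_diff_scaleR_sq)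
      ultimately show ?thesis unfolding M G by simp
    qed
    then have "(\<Sum>i=1..n. (norm (grad (f i) y))\<^sup>2) \<le> (\<Sum>i=1..n. M $ 1 $ 1 * (norm (y - z))\<^sup>2
        + 2 * M $ 1 $ 2 * ((y - z) \<bullet> grad (f i) y) + 2 * G\<^sup>2)"
      by (rule sum_mono)
    also have "\<dots> = real n * (M $ 1 $ 1 * (norm (y - z))\<^sup>2)
        + 2 * M $ 1 $ 2 * ((y - z) \<bullet> (\<Sum>i=1..n. grad (f i) y)) + 2 * real n * G\<^sup>2"
      by (simp add: sum.distrib inner_sum_right sum_distrib_left)
    finally show ?thesis .
  next
    case 2
    then obtain L where L: "\<And>i. i \<in> {1..n} \<Longrightarrow> L_smooth L (f i)"
      and M: "M $ 1 $ 1 = 2 * L\<^sup>2" "M $ 1 $ 2 = 0"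
      and G: "G\<^sup>2 = 1 / real n * (\<Sum>i=1..n. (norm (grad (f i) z))\<^sup>2)"
      unfolding case_II_def by (elim exE conjE) (rule that, simp_all)
    show ?thesis
    proof (rule avg[OF _ G])
      fix i assume "i \<in> {1..n}"
      then have "norm (grad (f i) y - grad (f i) z) \<le> L * norm (y - z)"
        using L by (auto simp: L_smooth_def)
      from power_mono[OF this, of 2]
      have "(norm (grad (f i) y - grad (f i) z))\<^sup>2 \<le> L\<^sup>2 * (norm (y - z))\<^sup>2"
        by (simp add: power_mult_distrib)
      then show "(norm (grad (f i) y))\<^sup>2 \<le> M $ 1 $ 1 * (norm (y - z))\<^sup>2
        + 2 * M $ 1 $ 2 * ((y - z) \<bullet> (grad (f i) y - grad (f i) z)) + 2 * (norm (grad (f i) z))\<^sup>2"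
        using norm_sq_le_twice[of "grad (f i) y" "grad (f i) z"] by (simp add: M)
    qed
  next
    case 3
    then obtain L where L: "\<And>i. i \<in> {1..n} \<Longrightarrow> f i \<in> F_class 0 L"
      and M: "M $ 1 $ 1 = 0" "M $ 1 $ 2 = L"
      and G: "G\<^sup>2 = 1 / real n * (\<Sum>i=1..n. (norm (grad (f i) z))\<^sup>2)"
      unfolding case_III_def by (elim exE conjE) (rule that, simp_all)
    show ?thesis
    proof (rule avg[OF _ G])
      fix i assume "i \<in> {1..n}"
      from F_class_cocoercive[OF L[OF this], of y z]
      show "(norm (grad (f i) y))\<^sup>2 \<le> M $ 1 $ 1 * (norm (y - z))\<^sup>2
        + 2 * M $ 1 $ 2 * ((y - z) \<bullet> (grad (f i) y - grad (f i) z)) + 2 * (norm (grad (f i) z))\<^sup>2"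
        using norm_sq_le_twice[of "grad (f i) y" "grad (f i) z"] by (simp add: M)
    qed
  next
    case 4
    then obtain L where L: "\<And>i. i \<in> {1..n} \<Longrightarrow> f i \<in> F_class m L"
      and M: "M $ 1 $ 1 = - 2 * m * L" "M $ 1 $ 2 = L + m"
      and G: "G\<^sup>2 = 1 / real n * (\<Sum>i=1..n. (norm (grad (f i) z))\<^sup>2)"
      unfolding case_IV_def by (elim exE conjE) (rule that, simp_all)
    show ?thesis
    proof (rule avg[OF _ G])
      fix i assume "i \<in> {1..n}"
      from F_class_cocoercive[OF L[OF this], of y z]
      show "(norm (grad (f i) y))\<^sup>2 \<le> M $ 1 $ 1 * (norm (y - z))\<^sup>2
        + 2 * M $ 1 $ 2 * ((y - z) \<bullet> (grad (f i) y - grad (f i) z)) + 2 * (norm (grad (f i) z))\<^sup>2"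
        using norm_sq_le_twice[of "grad (f i) y" "grad (f i) z"] by (simp add: M)
    qed
  qed
qed

text \<open>The combination M11 + 2 m M12 equals m^2, 2 L^2, 2 m L and 2 m^2 in cases I to
  IV.\<close>

lemma case_matrix:
  assumes n: "n \<ge> 1" and m: "m > 0"
    and cases: "case_I n f m z M G \<or> case_II n f m z M G \<or> case_III n f m z M G \<or> case_IV n f m z M G"
  shows "M $ 1 $ 2 = M $ 2 $ 1" "0 \<le> M $ 1 $ 1 + 2 * m * M $ 1 $ 2"
proof -
  have "\<exists>a b d. M = vector [vector [a, b], vector [b, d]] \<and> 0 \<le> a + 2 * m * b"
  proof -
    consider "case_I n f m z M G" | "case_II n f m z M G"
      | "case_III n f m z M G" | "case_IV n f m z M G" using cases by blast
    then show ?thesis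
    proof cases
      case 1
      moreover have "0 \<le> - m\<^sup>2 + 2 * m * m" by (simp add: power2_eq_square)
      ultimately show ?thesis unfolding case_I_def by blast
    next
      case 2
      then obtain L where "M = vector [vector [2 * L\<^sup>2, 0], vector [0, - 1]]"
        unfolding case_II_def by blast
      moreover have "0 \<le> 2 * L\<^sup>2 + 2 * m * 0" by simp
      ultimately show ?thesis by blast
    next
      case 3
      \<comment> \<open>The sign of L comes only from membership in \<open>F_class\<close>, so some
        component must exist.\<close>
      have n1: "1 \<in> {1..n}" using n by simp
      with 3 obtain L where "M = vector [vector [0, L], vector [L, - 1]]" "f 1 \<in> F_class 0 L"
        unfolding case_III_def using n1 by blast
      moreover from this(2) m have "0 \<le> 0 + 2 * m * L" by (simp add: F_class_def)
      ultimately show ?thesis by blast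
    next
      case 4
      then obtain L where "M = vector [vector [- 2 * m * L, L + m], vector [L + m, - 1]]"
        unfolding case_IV_def by blast
      moreover have "0 \<le> - 2 * m * L + 2 * m * (L + m)" using m by (simp add: distrib_left)
      ultimately show ?thesis by blast
    qed
  qed
  then show "M $ 1 $ 2 = M $ 2 $ 1" "0 \<le> M $ 1 $ 1 + 2 * m * M $ 1 $ 2"
    by (auto simp: vector_2)
qed

section \<open>Averaging over an independent uniform index\<close>

text \<open>Independence says that the law of Y restricted to the event X \<in> A is the law of Y
  scaled by the probability of that event; integrating h against both measures gives the
  product.\<close>

lemma (in prob_space) indep_rv_nn_integral_indicator:
  fixes h :: "'c \<Rightarrow> ennreal"
  assumes indep: "indep_rv S X T Y" and A: "A \<in> sets S" and h[measurable]: "h \<in> borel_measurable T"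
  shows "(\<integral>\<^sup>+\<omega>. indicator (X -` A \<inter> space M) \<omega> * h (Y \<omega>) \<partial>M)
    = emeasure M (X -` A \<inter> space M) * (\<integral>\<^sup>+\<omega>. h (Y \<omega>) \<partial>M)"
proof -
  have X[measurable]: "X \<in> measurable M S" and Y[measurable]: "Y \<in> measurable M T"
    using indep by (auto simp: indep_rv_def)
  define E where "E = X -` A \<inter> space M"
  have E[measurable]: "E \<in> sets M" unfolding E_def using X A by (rule measurable_sets)
  have distr: "distr (density M (indicator E)) T Y = scale_measure (emeasure M E) (distr M T Y)"
  proof (rule measure_eqI)
    fix B assume "B \<in> sets (distr (density M (indicator E)) T Y)"
    then have B: "B \<in> sets T" by simp
    let ?F = "Y -` B \<inter> space M"
    have F[measurable]: "?F \<in> sets M" using Y B by (rule measurable_sets)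
    have "prob (E \<inter> ?F) = prob E * prob ?F"
      using indep A B by (intro indep_setD) (auto simp: indep_rv_def E_def)
    then have "emeasure M (E \<inter> ?F) = emeasure M E * emeasure M ?F"
      by (simp add: emeasure_eq_measure ennreal_mult)
    then show "emeasure (distr (density M (indicator E)) T Y) B
        = emeasure (scale_measure (emeasure M E) (distr M T Y)) B"
      using B by (simp add: emeasure_distr emeasure_density nn_integral_set_ennreal
          indicator_inter_arith[symmetric])
  qed simp
  have "(\<integral>\<^sup>+\<omega>. indicator E \<omega> * h (Y \<omega>) \<partial>M) = (\<integral>\<^sup>+y. h y \<partial>distr (density M (indicator E)) T Y)"
    by (simp add: nn_integral_distr nn_integral_density)
  also have "\<dots> = emeasure M E * (\<integral>\<^sup>+\<omega>. h (Y \<omega>) \<partial>M)"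
    by (simp add: distr nn_integral_scale_measure nn_integral_distr)
  finally show ?thesis by (simp add: E_def)
qed

text \<open>Split by the value of X: each of the n events has probability 1 / n, and independence
  factors it out of the integral.\<close>

lemma (in prob_space) nn_integral_uniform_index:
  fixes h :: "nat \<Rightarrow> 'b \<Rightarrow> real"
  assumes n: "n \<ge> 1"
    and indep: "indep_rv (count_space {1..n}) X T Y"
    and unif: "distr M (count_space {1..n}) X = uniform_count_measure {1..n}"
    and h: "\<And>i. i \<in> {1..n} \<Longrightarrow> h i \<in> borel_measurable T"
    and nonneg: "\<And>i y. i \<in> {1..n} \<Longrightarrow> 0 \<le> h i y"
  shows "(\<integral>\<^sup>+\<omega>. ennreal (h (X \<omega>) (Y \<omega>)) \<partial>M)
    = (\<integral>\<^sup>+\<omega>. ennreal ((\<Sum>i=1..n. h i (Y \<omega>)) / real n) \<partial>M)"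
proof -
  have X[measurable]: "X \<in> measurable M (count_space {1..n})" and Y[measurable]: "Y \<in> measurable M T"
    using indep by (auto simp: indep_rv_def)
  note h[measurable]
  let ?E = "\<lambda>i. X -` {i} \<inter> space M"
  have E[measurable]: "?E i \<in> sets M" if "i \<in> {1..n}" for i
    using that by (intro measurable_sets[OF X]) simp
  have PE: "emeasure M (?E i) = ennreal (1 / real n)" if "i \<in> {1..n}" for i
  proof -
    have "emeasure M (?E i) = emeasure (distr M (count_space {1..n}) X) {i}"
      by (rule emeasure_distr[OF X, symmetric]) (use that in simp)
    also have "\<dots> = ennreal (1 / real n)"
      unfolding unif using that by (subst emeasure_uniform_count_measure) auto
    finally show ?thesis .
  qed
  have "(\<integral>\<^sup>+\<omega>. ennreal (h (X \<omega>) (Y \<omega>)) \<partial>M)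
      = (\<integral>\<^sup>+\<omega>. (\<Sum>i=1..n. indicator (?E i) \<omega> * ennreal (h i (Y \<omega>))) \<partial>M)"
  proof (rule nn_integral_cong)
    fix \<omega> assume \<omega>: "\<omega> \<in> space M"
    then have X\<omega>: "X \<omega> \<in> {1..n}" using measurable_space[OF X] by simp
    have "(\<Sum>i=1..n. indicator (?E i) \<omega> * ennreal (h i (Y \<omega>)))
        = (\<Sum>i=1..n. if X \<omega> = i then ennreal (h i (Y \<omega>)) else 0)"
      using \<omega> by (intro sum.cong) auto
    also have "\<dots> = ennreal (h (X \<omega>) (Y \<omega>))" using X\<omega> by simp
    finally show "ennreal (h (X \<omega>) (Y \<omega>)) = (\<Sum>i=1..n. indicator (?E i) \<omega> * ennreal (h i (Y \<omega>)))" ..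
  qed
  also have "\<dots> = (\<Sum>i=1..n. \<integral>\<^sup>+\<omega>. indicator (?E i) \<omega> * ennreal (h i (Y \<omega>)) \<partial>M)"
    by (intro nn_integral_sum) measurable
  also have "\<dots> = (\<Sum>i=1..n. ennreal (1 / real n) * (\<integral>\<^sup>+\<omega>. ennreal (h i (Y \<omega>)) \<partial>M))"
  proof (rule sum.cong[OF refl])
    fix i assume i: "i \<in> {1..n}"
    have "(\<lambda>y. ennreal (h i y)) \<in> borel_measurable T" using h[OF i] by simp
    from indep_rv_nn_integral_indicator[OF indep _ this, of "{i}"] PE[OF i] i
    show "(\<integral>\<^sup>+\<omega>. indicator (?E i) \<omega> * ennreal (h i (Y \<omega>)) \<partial>M)
        = ennreal (1 / real n) * (\<integral>\<^sup>+\<omega>. ennreal (h i (Y \<omega>)) \<partial>M)" by simp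
  qed
  also have "\<dots> = (\<Sum>i=1..n. \<integral>\<^sup>+\<omega>. ennreal (h i (Y \<omega>) / real n) \<partial>M)"
  proof (rule sum.cong[OF refl])
    fix i assume i: "i \<in> {1..n}"
    have [measurable]: "h i \<in> borel_measurable T" using h[OF i] .
    have "ennreal (1 / real n) * (\<integral>\<^sup>+\<omega>. ennreal (h i (Y \<omega>)) \<partial>M)
        = (\<integral>\<^sup>+\<omega>. ennreal (1 / real n) * ennreal (h i (Y \<omega>)) \<partial>M)"
      by (intro nn_integral_cmult[symmetric]) measurable
    also have "\<dots> = (\<integral>\<^sup>+\<omega>. ennreal (h i (Y \<omega>) / real n) \<partial>M)"
      using nonneg[OF i] by (intro nn_integral_cong) (simp add: ennreal_mult[symmetric])
    finally show "ennreal (1 / real n) * (\<integral>\<^sup>+\<omega>. ennreal (h i (Y \<omega>)) \<partial>M)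
        = (\<integral>\<^sup>+\<omega>. ennreal (h i (Y \<omega>) / real n) \<partial>M)" .
  qed
  also have "\<dots> = (\<integral>\<^sup>+\<omega>. (\<Sum>i=1..n. ennreal (h i (Y \<omega>) / real n)) \<partial>M)"
    by (intro nn_integral_sum[symmetric]) measurable
  also have "\<dots> = (\<integral>\<^sup>+\<omega>. ennreal ((\<Sum>i=1..n. h i (Y \<omega>)) / real n) \<partial>M)"
    unfolding sum_divide_distrib
    by (intro nn_integral_cong sum_ennreal divide_nonneg_nonneg nonneg) auto
  finally show ?thesis .
qed

text \<open>Turns a pointwise bound on the mean over i into a moment bound. It serves the error-free
  step with (r, s) and the error with (p, q).\<close>

lemma (in prob_space) nn_integral_uniform_index_le:
  fixes h :: "nat \<Rightarrow> 'b::euclidean_space \<Rightarrow> real"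
  assumes n: "n \<ge> 1"
    and indep: "indep_rv (count_space {1..n}) X borel Y"
    and unif: "distr M (count_space {1..n}) X = uniform_count_measure {1..n}"
    and h: "\<And>i. i \<in> {1..n} \<Longrightarrow> h i \<in> borel_measurable borel"
    and nonneg: "\<And>i y. i \<in> {1..n} \<Longrightarrow> 0 \<le> h i y"
    and bound: "\<And>y. (\<Sum>i=1..n. h i y) / real n \<le> a * (norm (y - z))\<^sup>2 + b"
    and ab: "0 \<le> a" "0 \<le> b"
  shows "(\<integral>\<^sup>+\<omega>. ennreal (h (X \<omega>) (Y \<omega>)) \<partial>M)
    \<le> ennreal a * (\<integral>\<^sup>+\<omega>. ennreal ((norm (Y \<omega> - z))\<^sup>2) \<partial>M) + ennreal b"
proof -
  have Y[measurable]: "Y \<in> borel_measurable M" using indep by (auto simp: indep_rv_def)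
  have "(\<integral>\<^sup>+\<omega>. ennreal (h (X \<omega>) (Y \<omega>)) \<partial>M)
      = (\<integral>\<^sup>+\<omega>. ennreal ((\<Sum>i=1..n. h i (Y \<omega>)) / real n) \<partial>M)"
    by (rule nn_integral_uniform_index[OF n indep unif h nonneg])
  also have "\<dots> \<le> (\<integral>\<^sup>+\<omega>. ennreal a * ennreal ((norm (Y \<omega> - z))\<^sup>2) + ennreal b \<partial>M)"
    using bound ab
    by (intro nn_integral_mono) (simp add: ennreal_mult[symmetric] ennreal_plus[symmetric] ennreal_leI del: ennreal_plus)
  also have "\<dots> = ennreal a * (\<integral>\<^sup>+\<omega>. ennreal ((norm (Y \<omega> - z))\<^sup>2) \<partial>M) + ennreal b"
    by (simp add: nn_integral_add nn_integral_cmult emeasure_space_1)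
  finally show ?thesis .
qed

section \<open>One step of biased SGD and the error bound\<close>

text \<open>The new deviation is the error-free step \<open>a\<close> plus -\<alpha> e_k. Their
  second moments are bounded separately and joined by Young's inequality; t stays free because its
  best value depends on the fixed point.\<close>

lemma biased_sgd_young:
  fixes f :: "nat \<Rightarrow> 'a::euclidean_space \<Rightarrow> real" and z :: 'a
  assumes n: "n \<ge> 1"
    and diff: "\<And>i y. i \<in> {1..n} \<Longrightarrow> f i differentiable (at y)"
    and sgd: "biased_sgd P n f step \<delta> c idx x e"
    and step: "step k = \<alpha>"
    and descent: "\<And>y. (\<Sum>i=1..n. (norm (y - z - \<alpha> *\<^sub>R grad (f i) y))\<^sup>2) / real n
      \<le> r * (norm (y - z))\<^sup>2 + s"
    and error: "\<And>y. (\<Sum>i=1..n. \<alpha>\<^sup>2 * (\<delta>\<^sup>2 * (norm (grad (f i) y))\<^sup>2 + c\<^sup>2)) / real n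
      \<le> p * (norm (y - z))\<^sup>2 + q"
    and nonneg: "0 \<le> p" "0 \<le> q" "0 \<le> r" "0 \<le> s"
    and t: "t > 0"
  defines "V \<equiv> \<lambda>k. \<integral>\<^sup>+\<omega>. ennreal ((norm (x k \<omega> - z))\<^sup>2) \<partial>P"
  shows "V (Suc k) \<le> ennreal ((1 + t) * r + (1 + 1/t) * p) * V k
    + ennreal ((1 + t) * s + (1 + 1/t) * q)"
proof -
  interpret prob_space P using sgd by (simp add: biased_sgd_def)
  have indep: "indep_rv (count_space {1..n}) (idx k) borel (x k)"
    and unif: "distr P (count_space {1..n}) (idx k) = uniform_count_measure {1..n}"
    and e[measurable]: "e k \<in> borel_measurable P"
    and upd: "AE \<omega> in P. x (Suc k) \<omega> = x k \<omega> - \<alpha> *\<^sub>R (grad (f (idx k \<omega>)) (x k \<omega>) + e k \<omega>)"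
    and err: "AE \<omega> in P. (norm (e k \<omega>))\<^sup>2
      \<le> \<delta>\<^sup>2 * (norm (grad (f (idx k \<omega>)) (x k \<omega>)))\<^sup>2 + c\<^sup>2"
    using sgd step by (auto simp: biased_sgd_def)
  have idx[measurable]: "idx k \<in> measurable P (count_space {1..n})"
    and x[measurable]: "x k \<in> borel_measurable P"
    using indep by (auto simp: indep_rv_def)
  have grad[measurable]: "grad (f i) \<in> borel_measurable borel" if "i \<in> {1..n}" for i
    using diff that by (intro borel_measurable_grad) auto
  define u where "u = (\<lambda>\<omega>. grad (f (idx k \<omega>)) (x k \<omega>))"
  have u[measurable]: "u \<in> borel_measurable P"
    \<comment> \<open>The index has countable range, so measurability may be checked for each fixed
      i in {1..n}.\<close>
    unfolding u_def
    by (rule measurable_compose_countable'[OF _ idx]) (auto intro: measurable_compose[OF x] grad)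
  define a where "a = (\<lambda>\<omega>. x k \<omega> - z - \<alpha> *\<^sub>R u \<omega>)"
  have [measurable]: "a \<in> borel_measurable P" unfolding a_def by measurable
  have A: "(\<integral>\<^sup>+\<omega>. ennreal ((norm (a \<omega>))\<^sup>2) \<partial>P) \<le> ennreal r * V k + ennreal s"
    unfolding a_def u_def V_def
    by (rule nn_integral_uniform_index_le[OF n indep unif _ _ descent])
      (use nonneg in measurable)
  have "(\<integral>\<^sup>+\<omega>. ennreal ((norm (- \<alpha> *\<^sub>R e k \<omega>))\<^sup>2) \<partial>P)
      \<le> (\<integral>\<^sup>+\<omega>. ennreal (\<alpha>\<^sup>2 * (\<delta>\<^sup>2 * (norm (u \<omega>))\<^sup>2 + c\<^sup>2)) \<partial>P)"
  proof (rule nn_integral_mono_AE)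
    show "AE \<omega> in P. ennreal ((norm (- \<alpha> *\<^sub>R e k \<omega>))\<^sup>2)
        \<le> ennreal (\<alpha>\<^sup>2 * (\<delta>\<^sup>2 * (norm (u \<omega>))\<^sup>2 + c\<^sup>2))"
      using err by eventually_elim
        (auto simp: u_def power_mult_distrib intro!: ennreal_leI mult_left_mono)
  qed
  also have "\<dots> \<le> ennreal p * V k + ennreal q"
    unfolding u_def V_def
    by (rule nn_integral_uniform_index_le[OF n indep unif _ _ error])
      (use nonneg in measurable)
  finally have B: "(\<integral>\<^sup>+\<omega>. ennreal ((norm (- \<alpha> *\<^sub>R e k \<omega>))\<^sup>2) \<partial>P) \<le> ennreal p * V k + ennreal q" .
  have "V (Suc k) \<le> (\<integral>\<^sup>+\<omega>. ennreal (1 + t) * ennreal ((norm (a \<omega>))\<^sup>2)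
      + ennreal (1 + 1/t) * ennreal ((norm (- \<alpha> *\<^sub>R e k \<omega>))\<^sup>2) \<partial>P)"
    unfolding V_def
  proof (rule nn_integral_mono_AE)
    show "AE \<omega> in P. ennreal ((norm (x (Suc k) \<omega> - z))\<^sup>2)
        \<le> ennreal (1 + t) * ennreal ((norm (a \<omega>))\<^sup>2)
          + ennreal (1 + 1/t) * ennreal ((norm (- \<alpha> *\<^sub>R e k \<omega>))\<^sup>2)"
      using upd
    proof eventually_elim
      fix \<omega> assume "x (Suc k) \<omega> = x k \<omega> - \<alpha> *\<^sub>R (grad (f (idx k \<omega>)) (x k \<omega>) + e k \<omega>)"
      then have "x (Suc k) \<omega> - z = a \<omega> + - \<alpha> *\<^sub>R e k \<omega>"
        by (simp add: a_def u_def algebra_simps)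
      then have "ennreal ((norm (x (Suc k) \<omega> - z))\<^sup>2)
          \<le> ennreal ((1 + t) * (norm (a \<omega>))\<^sup>2 + (1 + 1/t) * (norm (- \<alpha> *\<^sub>R e k \<omega>))\<^sup>2)"
        using norm_add_sq_young[OF t] by (metis ennreal_leI)
      also have "\<dots> = ennreal (1 + t) * ennreal ((norm (a \<omega>))\<^sup>2)
          + ennreal (1 + 1/t) * ennreal ((norm (- \<alpha> *\<^sub>R e k \<omega>))\<^sup>2)"
        using t by (subst ennreal_plus) (simp_all only: ennreal_mult zero_le_power2 mult_nonneg_nonneg
            add_nonneg_nonneg zero_le_one less_imp_le zero_le_divide_1_iff)
      finally show "ennreal ((norm (x (Suc k) \<omega> - z))\<^sup>2)
          \<le> ennreal (1 + t) * ennreal ((norm (a \<omega>))\<^sup>2)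
            + ennreal (1 + 1/t) * ennreal ((norm (- \<alpha> *\<^sub>R e k \<omega>))\<^sup>2)" .
    qed
  qed
  also have "\<dots> = ennreal (1 + t) * (\<integral>\<^sup>+\<omega>. ennreal ((norm (a \<omega>))\<^sup>2) \<partial>P)
      + ennreal (1 + 1/t) * (\<integral>\<^sup>+\<omega>. ennreal ((norm (- \<alpha> *\<^sub>R e k \<omega>))\<^sup>2) \<partial>P)"
    by (subst nn_integral_add, measurable) (subst (1 2) nn_integral_cmult, measurable)
  also have "\<dots> \<le> ennreal (1 + t) * (ennreal r * V k + ennreal s)
      + ennreal (1 + 1/t) * (ennreal p * V k + ennreal q)"
    by (intro add_mono mult_left_mono A B) auto
  also have "\<dots> = (ennreal ((1 + t) * r) * V k + ennreal ((1 + t) * s))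
      + (ennreal ((1 + 1/t) * p) * V k + ennreal ((1 + 1/t) * q))"
    using t nonneg by (simp only: ennreal_affine_scaled add_nonneg_nonneg zero_le_one less_imp_le
        zero_le_divide_1_iff)
  also have "\<dots> = (ennreal ((1 + t) * r) + ennreal ((1 + 1/t) * p)) * V k
      + (ennreal ((1 + t) * s) + ennreal ((1 + 1/t) * q))"
    by (simp only: distrib_right add_ac)
  also have "\<dots> = ennreal ((1 + t) * r + (1 + 1/t) * p) * V k
      + ennreal ((1 + t) * s + (1 + 1/t) * q)"
    using t nonneg by (simp only: ennreal_plus mult_nonneg_nonneg add_nonneg_nonneg zero_le_one less_imp_le
        zero_le_divide_1_iff)
  finally show ?thesis .
qed

theorem corollary2:
  fixes P :: "'w measure"
    and n :: nat
    and f :: "nat \<Rightarrow> 'a::euclidean_space \<Rightarrow> real"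
    and g :: "'a \<Rightarrow> real"
    and xstar :: 'a
    and idx :: "nat \<Rightarrow> 'w \<Rightarrow> nat"
    and x e :: "nat \<Rightarrow> 'w \<Rightarrow> 'a"
    and step :: "nat \<Rightarrow> real"
    and M :: "real^2^2"
    and m G \<delta> c \<alpha> Mt p q r s Ustar :: real
  assumes "n \<ge> 1"
    and "\<forall>i\<in>{1..n}. \<forall>y. f i differentiable (at y)"
    and "g = (\<lambda>y. 1 / real n * (\<Sum>i=1..n. f i y))"
    and "m > 0" and "g \<in> S_infty m" and "global_minimizer g xstar"
    and "\<delta> \<ge> 0" and "c \<ge> 0"
    and "biased_sgd P n f step \<delta> c idx x e"
    and "case_I n f m xstar M G \<or> case_II n f m xstar M G \<or>
         case_III n f m xstar M G \<or> case_IV n f m xstar M G"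
    and "Mt = M $ 1 $ 1 + 2 * m * M $ 1 $ 2"
    and "\<alpha> > 0" and "\<forall>k. step k = \<alpha>"
    and "M $ 2 $ 1 * \<alpha> \<le> 1"
    and "\<delta> = 0 \<or> M $ 2 $ 1 = 0"
    and "p = Mt * \<delta>\<^sup>2 * \<alpha>\<^sup>2"
    and "q = (c\<^sup>2 + 2 * G\<^sup>2 * \<delta>\<^sup>2) * \<alpha>\<^sup>2"
    and "r = 1 - 2 * m * \<alpha> + Mt * \<alpha>\<^sup>2"
    and "s = 2 * G\<^sup>2 * \<alpha>\<^sup>2"
    and "sqrt p + sqrt r < 1"
    and "Ustar = ((p - r) * (s - q) + q + s
            + 2 * sqrt (p * s\<^sup>2 + q\<^sup>2 * r + q * s * (1 - p - r)))
          / ((p - r)\<^sup>2 - 2 * (p + r) + 1)"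
  shows "(p \<ge> 0 \<and> q \<ge> 0 \<and> r \<ge> 0 \<and> s \<ge> 0) \<and>
    (Ustar \<ge> 0 \<and>
     (\<forall>U\<ge>0. (sqrt (p * U + q) + sqrt (r * U + s))\<^sup>2 = U \<longleftrightarrow> U = Ustar)) \<and>
    (\<forall>k. (\<integral>\<^sup>+ \<omega>. ennreal ((norm (x k \<omega> - xstar))\<^sup>2) \<partial>P)
       \<le> ennreal ((rate_term p q Ustar + rate_term r s Ustar) ^ k)
           * (\<integral>\<^sup>+ \<omega>. ennreal ((norm (x 0 \<omega> - xstar))\<^sup>2) \<partial>P)
         + ennreal Ustar)"
proof (intro conjI allI impI)
  note n = assms(1) and m = assms(4) and cases = assms(10) and \<alpha> = assms(12) and Mt = assms(11)
  have diff: "f i differentiable (at y)" if "i \<in> {1..n}" for i y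
    using assms(2) that by blast
  have grad_g: "grad g y = (1 / real n) *\<^sub>R (\<Sum>i=1..n. grad (f i) y)" for y
    unfolding assms(3) by (rule grad_average[OF diff])
  have g_diff: "g differentiable (at xstar)" using assms(5) by (simp add: S_infty_def)
  have stationary: "(\<Sum>i=1..n. grad (f i) xstar) = 0"
    using grad_global_minimizer[OF g_diff assms(6)] n unfolding grad_g by (simp only: scaleR_eq_0_iff) simp
  note M = case_matrix[OF n m cases]
  let ?d = "\<lambda>y. (norm (y - xstar))\<^sup>2"
  let ?in = "\<lambda>y. (y - xstar) \<bullet> grad g y"
  have second: "(\<Sum>i=1..n. (norm (grad (f i) y))\<^sup>2) / real n
      \<le> M $ 1 $ 1 * ?d y + 2 * M $ 1 $ 2 * ?in y + 2 * G\<^sup>2" for y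
  proof -
    have "(y - xstar) \<bullet> (\<Sum>i=1..n. grad (f i) y) = real n * ?in y"
      using n unfolding grad_g by simp
    with second_moment_case_bound[OF n stationary cases, of y] n show ?thesis
      by (simp only:) (simp add: field_simps)
  qed
  have ing: "m * ?d y \<le> ?in y" for y by (rule S_infty_grad_bound[OF assms(5) m assms(6)])
  have descent: "(\<Sum>i=1..n. (norm (y - xstar - \<alpha> *\<^sub>R grad (f i) y))\<^sup>2) / real n \<le> r * ?d y + s" for y
  proof -
    have "(\<Sum>i=1..n. (norm (y - xstar - \<alpha> *\<^sub>R grad (f i) y))\<^sup>2)
        = (\<Sum>i=1..n. ?d y - 2 * \<alpha> * ((y - xstar) \<bullet> grad (f i) y) + \<alpha>\<^sup>2 * (norm (grad (f i) y))\<^sup>2)"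
      by (simp only: norm_diff_scaleR_sq inner_commute)
    also have "\<dots> = real n * ?d y - 2 * \<alpha> * (real n * ?in y) + \<alpha>\<^sup>2 * (\<Sum>i=1..n. (norm (grad (f i) y))\<^sup>2)"
      using n unfolding grad_g
      by (simp add: sum.distrib sum_subtractf inner_sum_right sum_distrib_left)
    finally have "(\<Sum>i=1..n. (norm (y - xstar - \<alpha> *\<^sub>R grad (f i) y))\<^sup>2) / real n
        = ?d y - 2 * \<alpha> * ?in y + \<alpha>\<^sup>2 * ((\<Sum>i=1..n. (norm (grad (f i) y))\<^sup>2) / real n)"
      using n by (simp only:) (simp add: field_simps)
    also have "\<dots> \<le> ?d y - 2 * \<alpha> * ?in y + \<alpha>\<^sup>2 * (M $ 1 $ 1 * ?d y + 2 * M $ 1 $ 2 * ?in y + 2 * G\<^sup>2)"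
      by (intro add_left_mono mult_left_mono second) simp
    also have "\<dots> = (1 + \<alpha>\<^sup>2 * M $ 1 $ 1) * ?d y - 2 * \<alpha> * (1 - M $ 2 $ 1 * \<alpha>) * ?in y + s"
      by (simp add: assms(19) M(1) power2_eq_square[of \<alpha>] algebra_simps)
    \<comment> \<open>M21 \<alpha> \<le> 1 makes the coefficient of the inner product nonpositive,
      so its lower bound m * ?d y may replace it.\<close>
    also have "\<dots> \<le> (1 + \<alpha>\<^sup>2 * M $ 1 $ 1) * ?d y - 2 * \<alpha> * (1 - M $ 2 $ 1 * \<alpha>) * (m * ?d y) + s"
      using \<alpha> assms(14) by (intro add_right_mono diff_left_mono mult_left_mono ing) simp
    also have "\<dots> = r * ?d y + s"
      by (simp add: assms(18) Mt M(1) power2_eq_square[of \<alpha>] algebra_simps)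
    finally show ?thesis .
  qed
  have error: "(\<Sum>i=1..n. \<alpha>\<^sup>2 * (\<delta>\<^sup>2 * (norm (grad (f i) y))\<^sup>2 + c\<^sup>2)) / real n \<le> p * ?d y + q" for y
  proof -
    have "(\<Sum>i=1..n. \<alpha>\<^sup>2 * (\<delta>\<^sup>2 * (norm (grad (f i) y))\<^sup>2 + c\<^sup>2)) / real n
        = \<alpha>\<^sup>2 * (\<delta>\<^sup>2 * ((\<Sum>i=1..n. (norm (grad (f i) y))\<^sup>2) / real n) + c\<^sup>2)"
      using n by (simp add: sum.distrib sum_distrib_left[symmetric] field_simps)
    also have "\<dots> \<le> \<alpha>\<^sup>2 * (\<delta>\<^sup>2 * (M $ 1 $ 1 * ?d y + 2 * M $ 1 $ 2 * ?in y + 2 * G\<^sup>2) + c\<^sup>2)"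
      by (intro add_right_mono mult_left_mono second) simp_all
    \<comment> \<open>Here the inner product would need an upper bound; it drops out because either
      \<delta> = 0 or M12 = M21 = 0, and in the latter case \<open>Mt\<close> = M11.\<close>
    also have "\<dots> = p * ?d y + q"
      using assms(15)
      by (auto simp: assms(16,17) Mt M(1) algebra_simps)
    finally show ?thesis .
  qed
  show p: "0 \<le> p" using M(2) by (simp add: assms(16) Mt)
  show q: "0 \<le> q" by (simp add: assms(17))
  show s: "0 \<le> s" by (simp add: assms(19))
  \<comment> \<open>The descent bound dominates a mean of squares, so r * ?d y + s is nonnegative at
    every y. If r were negative, a point at distance \<open>T\<close> from the minimizer would make
    it -1.\<close>
  show r: "0 \<le> r"
  proof (rule ccontr)
    assume "\<not> 0 \<le> r"
    define T where "T = sqrt ((s + 1) / - r)"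
    have T: "T\<^sup>2 = (s + 1) / - r" using s \<open>\<not> 0 \<le> r\<close> by (simp add: T_def divide_nonneg_pos del: divide_minus_right minus_divide_right)
    obtain b :: 'a where b: "b \<in> Basis" using nonempty_Basis by blast
    have "0 \<le> (\<Sum>i=1..n. (norm (xstar + T *\<^sub>R b - xstar - \<alpha> *\<^sub>R grad (f i) (xstar + T *\<^sub>R b)))\<^sup>2) / real n"
      by (intro divide_nonneg_nonneg sum_nonneg) auto
    also have "\<dots> \<le> r * ?d (xstar + T *\<^sub>R b) + s" by (rule descent)
    also have "?d (xstar + T *\<^sub>R b) = T\<^sup>2" using b by simp
    also have "r * T\<^sup>2 + s < 0" using \<open>\<not> 0 \<le> r\<close> unfolding T by (simp add: field_simps)
    finally show False by simp
  qed
  note fp = sqrt_sum_fixed_point[OF p q r s assms(20,21)]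
  show U0: "0 \<le> Ustar" by (rule fp(1))
  show "((sqrt (p * U + q) + sqrt (r * U + s))\<^sup>2 = U) = (U = Ustar)" if U: "0 \<le> U" for U
  proof
    assume "U = Ustar"
    then show "(sqrt (p * U + q) + sqrt (r * U + s))\<^sup>2 = U" using fp by simp
  next
    assume "(sqrt (p * U + q) + sqrt (r * U + s))\<^sup>2 = U"
    then have "sqrt (p * U + q) + sqrt (r * U + s) = sqrt U"
      using U p q r s by (intro real_sqrt_unique[symmetric]) auto
    then show "U = Ustar"
      using sqrt_sum_fixed_point_not_less[OF p q r s assms(20)] U fp by (meson linorder_cases)
  qed
  fix k
  let ?V = "\<lambda>k. \<integral>\<^sup>+ \<omega>. ennreal ((norm (x k \<omega> - xstar))\<^sup>2) \<partial>P"
  show "?V k \<le> ennreal ((rate_term p q Ustar + rate_term r s Ustar) ^ k) * ?V 0 + ennreal Ustar"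
  proof (rule ennreal_affine_recursion[where V = ?V])
    show "0 \<le> rate_term p q Ustar + rate_term r s Ustar"
      using rate_term_nonneg p q r s U0 by simp
    show "\<exists>\<sigma>\<ge>0. ?V (Suc k) \<le> ennreal (rate_term p q Ustar + rate_term r s Ustar) * ?V k + ennreal \<sigma>
        \<and> (rate_term p q Ustar + rate_term r s Ustar) * Ustar + \<sigma> = Ustar" for k
      by (rule affine_bound_at_fixed_point[OF p q r s U0 assms(20) fp(2)])
        (rule biased_sgd_young[OF n diff assms(9) assms(13)[rule_format] descent error p q r s])
  qed (rule U0)
qed

end
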